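(* For any two loopless matroids $M_1$ and $M_2$, $$m_{M_1\oplus M_2}=m_{M_1}m_{M_2}.$$
   Context: The microlocal multiplicity of a loopless matroid $M$ is $$m_M=(-1)^{\mathrm{rk}M}\sum_{F\in\mathcal{L}(M)}2^{\mathrm{rk}F}\,\chi_{M^F}(1/2)\,P_{M_F}(1),$$ where $\mathcal{L}(M)$ is the lattice of all flats of $M$, with Möbius function $\mu$; for a flat $F$, $M^F$ is the localization (restriction of $M$ to $F$) and $M_F$ is the contraction of $M$ at $F$ (ground set $E\setminus F$, where $E$ is the ground set of $M$); $\chi_M(t)=\sum_{G\in\mathcal{L}(M)}\mu(\emptyset,G)t^{\mathrm{rk}M-\mathrm{rk}G}$ is the characteristic polynomial; and the Kazhdan–Lusztig polynomials $P_M(t)\in\mathbb{Z}[t]$ of loopless matroids are the unique family such that $P_M=1$ if $\mathrm{rk}M=0$; $\deg P_M<\frac12\mathrm{rk}M$ if $\mathrm{rk}M>0$; and $t^{\mathrm{rk}M}P_M(t^{-1})=\sum_{F\in\mathcal{L}(M)}\chi_{M^F}(t)P_{M_F}(t)$. *)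

theory Defs
  imports "HOL-Computational_Algebra.Polynomial" "HOL-Library.FuncSet"
begin

record 'a matroid =
  ground :: "'a set"
  indeps :: "'a set set"

locale loopless_matroid =
  fixes M :: "'a matroid" (structure)
  assumes finite_ground: "finite (ground M)"
    and indeps_ground: "I \<in> indeps M \<Longrightarrow> I \<subseteq> ground M"
    and indeps_empty: "{} \<in> indeps M"
    and indeps_subset: "I \<in> indeps M \<Longrightarrow> J \<subseteq> I \<Longrightarrow> J \<in> indeps M"
    and indeps_augment:
      "I \<in> indeps M \<Longrightarrow> J \<in> indeps M \<Longrightarrow> card I < card J \<Longrightarrow>
        \<exists>e\<in>J - I. insert e I \<in> indeps M"
    and loopless: "e \<in> ground M \<Longrightarrow> {e} \<in> indeps M"

definition rank_of :: "'a matroid \<Rightarrow> 'a set \<Rightarrow> nat" where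
  "rank_of M X = Max (card ` {I \<in> indeps M. I \<subseteq> X})"

definition rk :: "'a matroid \<Rightarrow> nat" where
  "rk M = rank_of M (ground M)"

definition flats :: "'a matroid \<Rightarrow> 'a set set" where
  "flats M = {F. F \<subseteq> ground M \<and> (\<forall>e\<in>ground M - F. rank_of M F < rank_of M (insert e F))}"

definition localization :: "'a matroid \<Rightarrow> 'a set \<Rightarrow> 'a matroid" where
  "localization M F = \<lparr>ground = F, indeps = {I \<in> indeps M. I \<subseteq> F}\<rparr>"

definition is_basis_of :: "'a matroid \<Rightarrow> 'a set \<Rightarrow> 'a set \<Rightarrow> bool" where
  "is_basis_of M X B \<longleftrightarrow>
    B \<in> indeps M \<and> B \<subseteq> X \<and> (\<forall>I\<in>indeps M. B \<subseteq> I \<and> I \<subseteq> X \<longrightarrow> I = B)"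

definition contraction :: "'a matroid \<Rightarrow> 'a set \<Rightarrow> 'a matroid" where
  "contraction M F =
    \<lparr>ground = ground M - F,
     indeps = {I. I \<subseteq> ground M - F \<and> (\<exists>B. is_basis_of M F B \<and> I \<union> B \<in> indeps M)}\<rparr>"

definition direct_sum :: "'a matroid \<Rightarrow> 'b matroid \<Rightarrow> ('a + 'b) matroid" where
  "direct_sum M N =
    \<lparr>ground = ground M <+> ground N,
     indeps = {I <+> J | I J. I \<in> indeps M \<and> J \<in> indeps N}\<rparr>"

text \<open>
  The Moebius function of a family \<open>L\<close> of finite sets ordered by inclusion. The value \<open>0\<close> for
  incomparable or foreign arguments is a convention; finiteness of \<open>G\<close> ensures termination.
\<close>

function moebius :: "'a set set \<Rightarrow> 'a set \<Rightarrow> 'a set \<Rightarrow> int" where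
  "moebius L F G =
    (if F \<in> L \<and> G \<in> L \<and> finite G \<and> F \<subseteq> G
     then if F = G then 1 else - (\<Sum>H\<in>{H \<in> L. F \<subseteq> H \<and> H \<subset> G}. moebius L F H)
     else 0)"
  by pat_completeness auto
termination
  by (relation "measure (\<lambda>(L, F, G). card G)") (auto intro: psubset_card_mono)

declare moebius.simps [simp del]

definition char_poly :: "'a matroid \<Rightarrow> int poly" where
  "char_poly M = (\<Sum>G\<in>flats M. monom (moebius (flats M) {} G) (rk M - rank_of M G))"

text \<open>
  The last condition is an identity between Laurent polynomials; it is expressed by evaluation at
  all nonzero rationals, which is equivalent since \<open>\<rat>\<close> is infinite. Restricting to extensional
  functions makes the family unique as a function on the whole type.
\<close>

definition is_KL_family :: "('a matroid \<Rightarrow> int poly) \<Rightarrow> bool" where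
  "is_KL_family P \<longleftrightarrow>
    P \<in> extensional {M. loopless_matroid M} \<and>
    (\<forall>M. loopless_matroid M \<longrightarrow>
      (rk M = 0 \<longrightarrow> P M = 1) \<and>
      (rk M > 0 \<longrightarrow> 2 * degree (P M) < rk M) \<and>
      (\<forall>t::rat. t \<noteq> 0 \<longrightarrow>
        t ^ rk M * poly (map_poly of_int (P M)) (inverse t) =
        (\<Sum>F\<in>flats M. poly (map_poly of_int (char_poly (localization M F))) t *
                       poly (map_poly of_int (P (contraction M F))) t)))"

definition KL_poly :: "'a matroid \<Rightarrow> int poly" where
  "KL_poly = (THE P. is_KL_family P)"

definition microlocal_mult :: "'a matroid \<Rightarrow> rat" where
  "microlocal_mult M =
    (-1) ^ rk M *
    (\<Sum>F\<in>flats M. 2 ^ rank_of M F *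
       poly (map_poly of_int (char_poly (localization M F))) (1 / 2) *
       of_int (poly (KL_poly (contraction M F)) 1))"

end

theory Submission
  imports Defs
begin

text \<open>
  Every ingredient of the microlocal multiplicity is multiplicative over direct sums. The flats of
  \<open>M1 \<oplus> M2\<close> are the disjoint unions \<open>F1 <+> F2\<close> of flats, ranks add, and both localization and
  contraction at \<open>F1 <+> F2\<close> are direct sums of the corresponding minors of the summands. The
  Moebius function of a product of lattices is the product of the Moebius functions, hence
  characteristic polynomials multiply. Once Kazhdan--Lusztig polynomials are known to multiply as
  well, the sum defining the multiplicity of \<open>M1 \<oplus> M2\<close> is the expanded product of the two sums for
  the summands, and the signs \<open>(-1) ^ rk\<close> agree because ranks add.

  The Kazhdan--Lusztig polynomials are given by a definite description, so nothing can be said about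
  them before the family is shown to exist and to be unique. Write \<open>flip_poly n p\<close> for
  \<open>t\<^sup>n p(1/t)\<close>. Since \<open>\<chi> = 1\<close> for the localization at the empty flat, the functional equation reads
  \<open>flip_poly (rk M) P = P + S\<close>, where \<open>S\<close> collects the terms of the nonempty flats and therefore
  involves only contractions with fewer elements. Two solutions differ by a polynomial that is fixed
  by \<open>flip_poly (rk M)\<close> and, in positive rank, has degree below \<open>rk M / 2\<close>; such a polynomial
  is zero, which gives uniqueness. A solution exists as soon as \<open>flip_poly (rk M) S = - S\<close>: take the negative of the part
  of \<open>S\<close> in degrees below \<open>rk M / 2\<close>. By induction this antisymmetry reduces to the statement that
  characteristic polynomials form a kernel (\<open>kernel_identity\<close>),
  \<open>\<Sum>F\<subseteq>G. t\<^bsup>rk F\<^esup> \<chi>\<^bsub>0F\<^esub>(1/t) \<chi>\<^bsub>FG\<^esub>(t) = 0\<close> for nonempty \<open>G\<close>, where \<open>\<chi>\<^bsub>FG\<^esub>\<close> is the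
  characteristic polynomial of the minor on the interval from \<open>F\<close> to \<open>G\<close>; that in turn is Moebius
  inversion, used on both sides.

  Multiplicativity of the Kazhdan--Lusztig polynomials follows from the same uniqueness argument:
  by induction on the ground set, \<open>P\<^bsub>M1\<^esub> P\<^bsub>M2\<^esub>\<close> satisfies the degree bound and the functional
  equation for \<open>M1 \<oplus> M2\<close> with the same \<open>S\<close>.
\<close>

section \<open>Rank, bases, and minors at flats\<close>

context loopless_matroid
begin

lemma finite_indep: "I \<in> indeps M \<Longrightarrow> finite I"
  using finite_ground finite_subset indeps_ground by metis

lemma finite_indeps: "finite (indeps M)"
  using finite_ground indeps_ground by (meson Pow_iff finite_Pow_iff finite_subset subsetI)

lemma indep_card_le_rank: "I \<in> indeps M \<Longrightarrow> I \<subseteq> X \<Longrightarrow> card I \<le> rank_of M X"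
  unfolding rank_of_def using finite_indeps by (intro Max_ge) auto

lemma rank_attained: "\<exists>I \<in> indeps M. I \<subseteq> X \<and> card I = rank_of M X"
proof -
  have "rank_of M X \<in> card ` {I \<in> indeps M. I \<subseteq> X}"
    unfolding rank_of_def using finite_indeps indeps_empty by (intro Max_in) auto
  then show ?thesis by auto
qed

lemma rank_mono: "X \<subseteq> Y \<Longrightarrow> rank_of M X \<le> rank_of M Y"
  using rank_attained[of X] indep_card_le_rank by (metis order_trans)

lemma rank_le_card: "finite X \<Longrightarrow> rank_of M X \<le> card X"
  using rank_attained[of X] card_mono by metis

lemma rank_empty [simp]: "rank_of M {} = 0"
  using rank_le_card[of "{}"] by simp

lemma indep_iff_rank: "I \<in> indeps M \<longleftrightarrow> I \<subseteq> ground M \<and> rank_of M I = card I"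
proof
  assume I: "I \<in> indeps M"
  then show "I \<subseteq> ground M \<and> rank_of M I = card I"
    using indeps_ground rank_le_card finite_indep indep_card_le_rank by (metis le_antisym order_refl)
next
  assume I: "I \<subseteq> ground M \<and> rank_of M I = card I"
  obtain J where "J \<in> indeps M" "J \<subseteq> I" "card J = rank_of M I" using rank_attained by blast
  with I finite_ground show "I \<in> indeps M" by (metis card_subset_eq finite_subset)
qed

lemma extend_to_rank:
  assumes "I \<in> indeps M" "I \<subseteq> X"
  obtains B where "B \<in> indeps M" "I \<subseteq> B" "B \<subseteq> X" "card B = rank_of M X"
proof -
  have "\<exists>B \<in> indeps M. I \<subseteq> B \<and> B \<subseteq> X \<and> card B = rank_of M X"
    using assms
  proof (induction "rank_of M X - card I" arbitrary: I rule: less_induct)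
    case less
    show ?case
    proof (cases "card I = rank_of M X")
      case False
      with less have lt: "card I < rank_of M X" using indep_card_le_rank by (metis le_neq_implies_less)
      obtain J where J: "J \<in> indeps M" "J \<subseteq> X" "card J = rank_of M X" using rank_attained by blast
      then obtain e where e: "e \<in> J - I" "insert e I \<in> indeps M"
        using indeps_augment[OF less.prems(1) J(1)] lt by auto
      have "card (insert e I) = Suc (card I)" using e finite_indep less by auto
      then have "\<exists>B \<in> indeps M. insert e I \<subseteq> B \<and> B \<subseteq> X \<and> card B = rank_of M X"
        using less.hyps[of "insert e I"] e lt J less.prems by auto
      then show ?thesis by auto
    qed (use less in auto)
  qed
  then show ?thesis using that by blast
qed

lemma is_basis_of_iff: "is_basis_of M X B \<longleftrightarrow> B \<in> indeps M \<and> B \<subseteq> X \<and> card B = rank_of M X"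
proof
  assume B: "is_basis_of M X B"
  then have "B \<in> indeps M" "B \<subseteq> X" by (auto simp: is_basis_of_def)
  then obtain B' where "B' \<in> indeps M" "B \<subseteq> B'" "B' \<subseteq> X" "card B' = rank_of M X"
    using extend_to_rank by blast
  with B show "B \<in> indeps M \<and> B \<subseteq> X \<and> card B = rank_of M X"
    unfolding is_basis_of_def by metis
next
  assume B: "B \<in> indeps M \<and> B \<subseteq> X \<and> card B = rank_of M X"
  then show "is_basis_of M X B"
    unfolding is_basis_of_def using indep_card_le_rank finite_indep
    by (metis card_seteq)
qed

lemma basis_exists: obtains B where "is_basis_of M X B"
  using rank_attained is_basis_of_iff by metis

text \<open>
  Extending \<open>B\<close> to a maximal independent subset \<open>C\<close> of \<open>X \<union> F\<close> adds only elements of \<open>X\<close>, because \<open>B\<close>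
  is already maximal in \<open>F\<close>. So \<open>X \<union> B\<close> is independent exactly when \<open>C\<close> exhausts it, which is a
  condition on ranks that no longer mentions the basis \<open>B\<close>.
\<close>

lemma rank_union_basis:
  assumes B: "is_basis_of M F B" and disj: "X \<inter> F = {}" and X: "finite X"
  shows "X \<union> B \<in> indeps M \<longleftrightarrow> X \<subseteq> ground M \<and> rank_of M (X \<union> F) = card X + rank_of M F"
proof -
  have B': "B \<in> indeps M" "B \<subseteq> F" "card B = rank_of M F" using B is_basis_of_iff by auto
  have fin: "finite B" using B' finite_indep by auto
  have card: "card (X \<union> B) = card X + card B"
    using disj B'(2) X fin by (intro card_Un_disjoint) auto
  obtain C where C: "C \<in> indeps M" "B \<subseteq> C" "C \<subseteq> X \<union> F" "card C = rank_of M (X \<union> F)"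
    using extend_to_rank[OF B'(1), of "X \<union> F"] B' by blast
  have "C \<inter> F \<in> indeps M" using C indeps_subset by blast
  moreover have "B \<subseteq> C \<inter> F" using C B' by simp
  ultimately have "C \<inter> F = B" using B unfolding is_basis_of_def by simp
  then have CX: "C \<subseteq> X \<union> B" using C by blast
  show ?thesis
  proof
    assume ind: "X \<union> B \<in> indeps M"
    have "card C \<le> card X + card B" using CX card X fin by (metis card_mono finite_UnI)
    moreover have "card X + card B \<le> rank_of M (X \<union> F)"
      using indep_card_le_rank[OF ind, of "X \<union> F"] card B' by auto
    ultimately show "X \<subseteq> ground M \<and> rank_of M (X \<union> F) = card X + rank_of M F"
      using C B' indeps_ground[OF ind] by auto
  next
    assume "X \<subseteq> ground M \<and> rank_of M (X \<union> F) = card X + rank_of M F"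
    then have "card C = card (X \<union> B)" using C card B' by simp
    then have "C = X \<union> B" using CX X fin card_subset_eq by (metis finite_UnI)
    then show "X \<union> B \<in> indeps M" using C by simp
  qed
qed

lemma ground_contraction [simp]: "ground (contraction M F) = ground M - F"
  by (simp add: contraction_def)

text \<open>
  By the previous criterion all bases of \<open>F\<close> impose the same condition, and that condition speaks of
  ranks only. This is how minors are compared below.
\<close>

lemma indep_contraction_iff:
  "I \<in> indeps (contraction M F) \<longleftrightarrow>
    I \<subseteq> ground M - F \<and> rank_of M (I \<union> F) = card I + rank_of M F"
  (is "_ \<longleftrightarrow> ?R")
proof -
  obtain B where B: "is_basis_of M F B" by (rule basis_exists)
  have "I \<union> B' \<in> indeps M \<longleftrightarrow> rank_of M (I \<union> F) = card I + rank_of M F"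
    if "I \<subseteq> ground M - F" "is_basis_of M F B'" for B'
  proof -
    have "finite I" "I \<inter> F = {}" using that finite_ground by (auto intro: finite_subset)
    then show ?thesis using rank_union_basis[OF that(2)] that by blast
  qed
  with B show ?thesis unfolding contraction_def by auto
qed

text \<open>
  With one fixed basis \<open>B\<close>, the exchange axiom for the contraction is the exchange axiom of \<open>M\<close>
  applied to \<open>I \<union> B\<close> and \<open>J \<union> B\<close>.
\<close>

lemma indep_contraction_basis:
  assumes "is_basis_of M F B"
  shows "I \<in> indeps (contraction M F) \<longleftrightarrow> I \<subseteq> ground M - F \<and> I \<union> B \<in> indeps M"
proof -
  have "I \<subseteq> ground M - F \<Longrightarrow> finite I \<and> I \<inter> F = {}"
    using finite_ground by (auto intro: finite_subset)
  then show ?thesis using rank_union_basis[OF assms] indep_contraction_iff by blast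
qed

lemma flat_subset: "F \<in> flats M \<Longrightarrow> F \<subseteq> ground M"
  by (simp add: flats_def)

lemma finite_flat: "F \<in> flats M \<Longrightarrow> finite F"
  using flat_subset finite_ground finite_subset by blast

lemma finite_flats: "finite (flats M)"
  using flat_subset finite_ground by (meson Pow_iff finite_Pow_iff finite_subset subsetI)

lemma rank_insert_le: "rank_of M (insert e X) \<le> Suc (rank_of M X)"
proof -
  obtain I where I: "I \<in> indeps M" "I \<subseteq> insert e X" "card I = rank_of M (insert e X)"
    using rank_attained by blast
  then have "I - {e} \<in> indeps M" "I - {e} \<subseteq> X" using indeps_subset by auto
  then have "card (I - {e}) \<le> rank_of M X" using indep_card_le_rank by blast
  moreover have "card I \<le> Suc (card (I - {e}))"
    using card_Suc_Diff1[of I e] finite_indep[OF I(1)] by (cases "e \<in> I") auto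
  ultimately show ?thesis using I by simp
qed

lemma contraction_loopless:
  assumes F: "F \<in> flats M"
  shows "loopless_matroid (contraction M F)"
proof -
  obtain B where B: "is_basis_of M F B" by (rule basis_exists)
  have B': "B \<in> indeps M" "B \<subseteq> F" "card B = rank_of M F" using B is_basis_of_iff by auto
  have BF: "card (I \<union> B) = card I + card B" if "I \<subseteq> ground M - F" for I
    using that B'(2) finite_indep[OF B'(1)] finite_ground
    by (intro card_Un_disjoint) (auto intro: finite_subset)
  note ind = indep_contraction_basis[OF B]
  show ?thesis
  proof
    show "finite (ground (contraction M F))" using finite_ground by simp
    show "{} \<in> indeps (contraction M F)" using ind B' by simp
    show "I \<subseteq> ground (contraction M F)" if "I \<in> indeps (contraction M F)" for I
      using that ind by simp
    show "J \<in> indeps (contraction M F)" if "I \<in> indeps (contraction M F)" "J \<subseteq> I" for I J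
      using that ind indeps_subset[of "I \<union> B" "J \<union> B"] by blast
    \<comment> \<open>This is where it matters that the contracted set is a flat.\<close>
    show "{e} \<in> indeps (contraction M F)" if "e \<in> ground (contraction M F)" for e
    proof -
      have "rank_of M F < rank_of M (insert e F)" using F that by (auto simp: flats_def)
      then have "rank_of M (insert e F) = Suc (rank_of M F)" using rank_insert_le[of e F] by simp
      then show ?thesis using that by (simp add: indep_contraction_iff)
    qed
    show "\<exists>e\<in>J - I. insert e I \<in> indeps (contraction M F)"
      if I: "I \<in> indeps (contraction M F)" and J: "J \<in> indeps (contraction M F)"
        and lt: "card I < card J" for I J
    proof -
      have "card (I \<union> B) < card (J \<union> B)" using I J lt BF ind by simp
      then obtain e where e: "e \<in> (J \<union> B) - (I \<union> B)" "insert e (I \<union> B) \<in> indeps M"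
        using indeps_augment[of "I \<union> B" "J \<union> B"] I J ind by blast
      then have "insert e I \<in> indeps (contraction M F)" using I J ind by auto
      with e show ?thesis by auto
    qed
  qed
qed

lemma rank_contraction:
  assumes X: "X \<subseteq> ground M - F"
  shows "rank_of (contraction M F) X = rank_of M (X \<union> F) - rank_of M F"
proof -
  let ?I = "{I \<in> indeps (contraction M F). I \<subseteq> X}"
  obtain B where B: "is_basis_of M F B" by (rule basis_exists)
  have B': "B \<in> indeps M" "B \<subseteq> F" "card B = rank_of M F" using B is_basis_of_iff by auto
  obtain C where C: "C \<in> indeps M" "B \<subseteq> C" "C \<subseteq> X \<union> F" "card C = rank_of M (X \<union> F)"
    using extend_to_rank[OF B'(1), of "X \<union> F"] B' by blast
  have "C \<inter> F \<in> indeps M" using C indeps_subset by blast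
  moreover have "B \<subseteq> C \<inter> F" using C B' by simp
  ultimately have CF: "C \<inter> F = B" using B unfolding is_basis_of_def by simp
  have "C - B \<union> B = C" using C by blast
  then have mem: "C - B \<in> ?I" using indep_contraction_basis[OF B] C CF X by auto
  have "card (C - B) = rank_of M (X \<union> F) - rank_of M F"
    using C B' card_Diff_subset finite_indep by metis
  moreover have "card I \<le> rank_of M (X \<union> F) - rank_of M F" if "I \<in> ?I" for I
  proof -
    have "rank_of M (I \<union> F) \<le> rank_of M (X \<union> F)" using that by (intro rank_mono) auto
    then show ?thesis using that indep_contraction_iff[of I F] by auto
  qed
  moreover have "finite ?I"
    using finite_ground X by (intro finite_subset[of ?I "Pow (ground M)"]) auto
  ultimately show ?thesis
    unfolding rank_of_def[of "contraction M F"] using mem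
    by (intro Max_eqI) (auto intro!: image_eqI[of _ card "C - B"])
qed

lemma rk_contraction:
  "F \<subseteq> ground M \<Longrightarrow> rk (contraction M F) = rk M - rank_of M F"
  unfolding rk_def using rank_contraction[of "ground M - F" F] by (simp add: Un_absorb2)

lemma flats_contraction:
  assumes "F \<subseteq> ground M"
  shows "flats (contraction M F) = (\<lambda>G. G - F) ` {G \<in> flats M. F \<subseteq> G}"
proof -
  have *: "H \<in> flats (contraction M F) \<longleftrightarrow> H \<union> F \<in> flats M" if H: "H \<subseteq> ground M - F" for H
  proof -
    have "rank_of (contraction M F) H < rank_of (contraction M F) (insert e H) \<longleftrightarrow>
          rank_of M (H \<union> F) < rank_of M (insert e (H \<union> F))" if "e \<in> ground M - F" for e
      using rank_contraction[OF H] rank_contraction[of "insert e H" F] that H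
        rank_mono[of F "H \<union> F"] rank_mono[of F "insert e (H \<union> F)"] by auto
    with H assms show ?thesis unfolding flats_def by auto
  qed
  show ?thesis
  proof (intro equalityI subsetI)
    fix H assume H: "H \<in> flats (contraction M F)"
    then have sub: "H \<subseteq> ground M - F" by (simp add: flats_def)
    then have "H \<union> F \<in> flats M" "H = (H \<union> F) - F" using * H by auto
    then show "H \<in> (\<lambda>G. G - F) ` {G \<in> flats M. F \<subseteq> G}" by blast
  next
    fix H assume "H \<in> (\<lambda>G. G - F) ` {G \<in> flats M. F \<subseteq> G}"
    then obtain G where G: "G \<in> flats M" "F \<subseteq> G" "H = G - F" by auto
    then have "H \<union> F = G" "H \<subseteq> ground M - F" using flat_subset by auto
    with * G show "H \<in> flats (contraction M F)" by simp
  qed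
qed

lemma ground_localization [simp]: "ground (localization M F) = F"
  by (simp add: localization_def)

lemma rank_localization: "X \<subseteq> F \<Longrightarrow> rank_of (localization M F) X = rank_of M X"
proof -
  assume "X \<subseteq> F"
  then have "{I \<in> indeps (localization M F). I \<subseteq> X} = {I \<in> indeps M. I \<subseteq> X}"
    by (auto simp: localization_def)
  then show ?thesis by (simp add: rank_of_def)
qed

lemma rk_localization [simp]: "rk (localization M F) = rank_of M F"
  by (simp add: rk_def rank_localization)

lemma localization_loopless:
  assumes "F \<subseteq> ground M"
  shows "loopless_matroid (localization M F)"
proof
  show "finite (ground (localization M F))" using assms finite_ground finite_subset by auto
  show "\<exists>e\<in>J - I. insert e I \<in> indeps (localization M F)"
    if "I \<in> indeps (localization M F)" "J \<in> indeps (localization M F)" "card I < card J" for I J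
    using that indeps_augment[of I J] by (auto simp: localization_def)
qed (use assms indeps_empty indeps_subset loopless in \<open>auto simp: localization_def\<close>)

text \<open>
  An element outside the closure of a set is outside the closure of each subset. A maximal
  independent set of \<open>Y\<close> that extends one of \<open>X\<close> stays independent when \<open>e\<close> is added, and so does its
  part in \<open>X\<close>.
\<close>

lemma rank_insert_antimono:
  assumes "X \<subseteq> Y" "rank_of M Y < rank_of M (insert e Y)"
  shows "rank_of M X < rank_of M (insert e X)"
proof -
  obtain B where B: "is_basis_of M X B" by (rule basis_exists)
  then have B': "B \<in> indeps M" "B \<subseteq> X" "card B = rank_of M X" using is_basis_of_iff by auto
  obtain C where C: "C \<in> indeps M" "B \<subseteq> C" "C \<subseteq> Y" "card C = rank_of M Y"
    using extend_to_rank[OF B'(1), of Y] B' assms by blast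
  obtain D where D: "D \<in> indeps M" "C \<subseteq> D" "D \<subseteq> insert e Y" "card D = rank_of M (insert e Y)"
    using extend_to_rank[OF C(1), of "insert e Y"] C by blast
  have "e \<in> D"
  proof (rule ccontr)
    assume "e \<notin> D"
    then have "card D \<le> rank_of M Y" using D indep_card_le_rank[of D Y] by blast
    then show False using D assms by simp
  qed
  have "e \<notin> Y" using assms by (metis insert_absorb less_irrefl)
  have "insert e B \<in> indeps M" using \<open>e \<in> D\<close> C D indeps_subset by (meson insert_subset order_trans)
  then have "card (insert e B) \<le> rank_of M (insert e X)"
    using B' indep_card_le_rank by (meson insert_mono)
  moreover have "card (insert e B) = Suc (card B)"
    using \<open>e \<notin> Y\<close> B' assms finite_indep[OF B'(1)] by (intro card_insert_disjoint) auto
  ultimately show ?thesis using B' by simp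
qed

lemma flats_localization:
  assumes F: "F \<in> flats M"
  shows "flats (localization M F) = {G \<in> flats M. G \<subseteq> F}"
proof (intro equalityI subsetI)
  fix G assume G: "G \<in> flats (localization M F)"
  then have sub: "G \<subseteq> F" by (simp add: flats_def)
  have "rank_of M G < rank_of M (insert e G)" if e: "e \<in> ground M - G" for e
  proof (cases "e \<in> F")
    case True
    then have lt: "rank_of (localization M F) G < rank_of (localization M F) (insert e G)"
      using G e by (simp add: flats_def)
    from True show ?thesis
      using lt sub rank_localization[of G F] rank_localization[of "insert e G" F] by simp
  next
    case False
    then show ?thesis using F e sub rank_insert_antimono by (auto simp: flats_def)
  qed
  with sub flat_subset[OF F] show "G \<in> {G \<in> flats M. G \<subseteq> F}" by (auto simp: flats_def)
next
  fix G assume G: "G \<in> {G \<in> flats M. G \<subseteq> F}"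
  then show "G \<in> flats (localization M F)"
    using flat_subset[OF F] rank_localization[of G F] rank_localization[of "insert e G" F for e]
    by (auto simp: flats_def)
qed

lemma empty_flat: "{} \<in> flats M"
proof -
  have "0 < rank_of M {e}" if "e \<in> ground M" for e
    using indep_card_le_rank[OF loopless[OF that], of "{e}"] by simp
  then show ?thesis by (simp add: flats_def)
qed

lemma rank_pos:
  assumes "X \<subseteq> ground M" "X \<noteq> {}"
  shows "rank_of M X > 0"
proof -
  from assms obtain e where "e \<in> X" "e \<in> ground M" by auto
  then show ?thesis using indep_card_le_rank[OF loopless, of e X] by simp
qed

text \<open>
  The independent sets are the sets whose rank is their cardinality, so a matroid is determined by
  its rank function.
\<close>

lemma matroid_eqI:
  assumes N: "loopless_matroid N" and g: "ground M = ground N"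
    and r: "\<And>X. X \<subseteq> ground M \<Longrightarrow> rank_of M X = rank_of N X"
  shows "M = N"
proof -
  have "indeps M = indeps N"
    using r g by (auto simp: indep_iff_rank loopless_matroid.indep_iff_rank[OF N])
  with g show ?thesis by (cases M, cases N) simp
qed

lemma contraction_empty [simp]: "contraction M {} = M"
  by (rule loopless_matroid.matroid_eqI[symmetric]) 
    (use contraction_loopless[OF empty_flat] rank_contraction[of _ "{}"] loopless_matroid_axioms in auto)

lemma contraction_contraction:
  assumes F: "F \<in> flats M" and G: "G \<in> flats M" and FG: "F \<subseteq> G"
  shows "contraction (contraction M F) (G - F) = contraction M G"
proof -
  interpret C: loopless_matroid "contraction M F" by (rule contraction_loopless[OF F])
  have GF: "G - F \<in> flats (contraction M F)"
    using F G FG flats_contraction flat_subset by auto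
  have sub: "G \<subseteq> ground M" using G flat_subset by auto
  show ?thesis
  proof (rule loopless_matroid.matroid_eqI)
    show "loopless_matroid (contraction (contraction M F) (G - F))"
      by (rule C.contraction_loopless[OF GF])
    show "loopless_matroid (contraction M G)" by (rule contraction_loopless[OF G])
    show "ground (contraction (contraction M F) (G - F)) = ground (contraction M G)"
      using FG by auto
    fix X assume "X \<subseteq> ground (contraction (contraction M F) (G - F))"
    then have X: "X \<subseteq> ground M - G" "X \<subseteq> ground (contraction M F) - (G - F)" by auto
    have u: "X \<union> (G - F) \<union> F = X \<union> G" "G - F \<union> F = G" using FG by auto
    have "X \<union> (G - F) \<subseteq> ground M - F" "G - F \<subseteq> ground M - F" using X FG sub by auto
    then show "rank_of (contraction (contraction M F) (G - F)) X = rank_of (contraction M G) X"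
      using C.rank_contraction[OF X(2)] rank_contraction[OF X(1)] rank_contraction[of _ F] u
        rank_mono[OF FG] rank_mono[of G "X \<union> G"] by simp
  qed
qed

end

section \<open>Moebius functions of families of finite sets\<close>

definition interval :: "'a set set \<Rightarrow> 'a set \<Rightarrow> 'a set \<Rightarrow> 'a set set" where
  "interval L F G = {H \<in> L. F \<subseteq> H \<and> H \<subseteq> G}"

lemma mem_interval [simp]: "H \<in> interval L F G \<longleftrightarrow> H \<in> L \<and> F \<subseteq> H \<and> H \<subseteq> G"
  by (simp add: interval_def)

lemma finite_interval: "finite G \<Longrightarrow> finite (interval L F G)"
  by (rule finite_subset[of _ "Pow G"]) auto

lemma interval_self [simp]: "F \<in> L \<Longrightarrow> interval L F F = {F}"
  by (auto simp: interval_def)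

lemma moebius_self [simp]: "F \<in> L \<Longrightarrow> finite F \<Longrightarrow> moebius L F F = 1"
  by (simp add: moebius.simps)

lemma sum_moebius:
  assumes "F \<in> L" "G \<in> L" "finite G" "F \<subseteq> G"
  shows "(\<Sum>H\<in>interval L F G. moebius L F H) = (if F = G then 1 else 0)"
proof (cases "F = G")
  case False
  have "interval L F G = insert G {H \<in> L. F \<subseteq> H \<and> H \<subset> G}" using assms by (auto simp: interval_def)
  moreover have "finite {H \<in> L. F \<subseteq> H \<and> H \<subset> G}"
    by (rule finite_subset[of _ "Pow G"]) (use assms in auto)
  ultimately show ?thesis using False assms by (simp add: moebius.simps[of L F G])
qed (use assms in simp)

text \<open>
  The recursion for the Moebius function determines it from its sums over intervals. Values of
  Moebius functions on different families are compared by checking such sums.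
\<close>

lemma moebius_unique:
  assumes F: "F \<in> L" and G: "G \<in> L" "finite G" "F \<subseteq> G"
    and g: "\<And>K. K \<in> interval L F G \<Longrightarrow> (\<Sum>H\<in>interval L F K. g H) = (if F = K then 1 else 0)"
  shows "moebius L F G = g G"
  using G g
proof (induction "card G" arbitrary: G rule: less_induct)
  case less
  let ?I = "interval L F G - {G}"
  have fin: "finite (interval L F G)" using less by (simp add: finite_interval)
  have "moebius L F H = g H" if H: "H \<in> ?I" for H
  proof (rule less.hyps)
    show "card H < card G" using H less.prems by (intro psubset_card_mono) auto
    show "finite H" using H less.prems finite_subset by auto
    show "(\<Sum>H\<in>interval L F K. g H) = (if F = K then 1 else 0)" if "K \<in> interval L F H" for K
      using H that by (intro less.prems(4)) auto
  qed (use H in auto)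
  then have "(\<Sum>H\<in>?I. moebius L F H) = (\<Sum>H\<in>?I. g H)" by (rule sum.cong[OF refl])
  moreover have "(\<Sum>H\<in>interval L F G. moebius L F H) = (\<Sum>H\<in>interval L F G. g H)"
    using less.prems F by (simp add: sum_moebius)
  ultimately show ?case
    using less.prems fin sum.remove[of "interval L F G" G "moebius L F"]
      sum.remove[of "interval L F G" G g] by simp
qed

text \<open>
  In the incidence algebra \<open>sum_moebius\<close> says that \<open>\<mu>\<close> is inverse to \<open>\<zeta>\<close> on one side; this is the other
  side. Let \<open>H \<noteq> K\<close>. With \<open>\<nu> H\<close> for the sum in question, associativity gives
  \<open>\<mu>(H, K) = \<Sum>X. \<mu>(H, X) \<nu> X\<close>. By induction only \<open>X = H\<close> and \<open>X = K\<close> contribute to the right-hand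
  side, and the term of \<open>K\<close> is \<open>\<mu>(H, K)\<close> itself, so \<open>\<nu> H = 0\<close>.
\<close>

lemma sum_moebius_dual:
  assumes "H \<in> L" "K \<in> L" "finite K" "H \<subseteq> K"
  shows "(\<Sum>F\<in>interval L H K. moebius L F K) = (if H = K then 1 else 0)"
  using assms
proof (induction "card (K - H)" arbitrary: H rule: less_induct)
  case less
  let ?\<nu> = "\<lambda>H. \<Sum>F\<in>interval L H K. moebius L F K"
  show ?case
  proof (cases "H = K")
    case False
    have fin: "finite (interval L H K)" using less.prems by (simp add: finite_interval)
    have fin': "finite F" if "F \<subseteq> K" for F using that less.prems finite_subset by auto
    have "moebius L H K = (\<Sum>F\<in>interval L H K. if H = F then moebius L F K else 0)"
      using less.prems fin by (simp add: sum.delta)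
    also have "\<dots> = (\<Sum>F\<in>interval L H K. (\<Sum>X\<in>interval L H F. moebius L H X) * moebius L F K)"
      using less.prems fin' by (intro sum.cong refl) (auto simp: sum_moebius)
    also have "\<dots> = (\<Sum>F\<in>interval L H K. \<Sum>X\<in>{X \<in> interval L H K. X \<subseteq> F}.
        moebius L H X * moebius L F K)"
    proof (intro sum.cong refl)
      fix F assume "F \<in> interval L H K"
      then have "interval L H F = {X \<in> interval L H K. X \<subseteq> F}"
        unfolding interval_def by blast
      then show "(\<Sum>X\<in>interval L H F. moebius L H X) * moebius L F K =
          (\<Sum>X\<in>{X \<in> interval L H K. X \<subseteq> F}. moebius L H X * moebius L F K)"
        by (simp add: sum_distrib_right)
    qed
    also have "\<dots> = (\<Sum>X\<in>interval L H K. \<Sum>F\<in>{F \<in> interval L H K. X \<subseteq> F}.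
        moebius L H X * moebius L F K)"
      using fin by (intro sum.swap_restrict)
    also have "\<dots> = (\<Sum>X\<in>interval L H K. moebius L H X * ?\<nu> X)"
    proof (intro sum.cong refl)
      fix X assume "X \<in> interval L H K"
      then have "interval L X K = {F \<in> interval L H K. X \<subseteq> F}"
        unfolding interval_def by blast
      then show "(\<Sum>F\<in>{F \<in> interval L H K. X \<subseteq> F}. moebius L H X * moebius L F K) =
          moebius L H X * ?\<nu> X"
        by (simp add: sum_distrib_left)
    qed
    also have "\<dots> = ?\<nu> H + (\<Sum>X\<in>interval L H K - {H}. moebius L H X * ?\<nu> X)"
      using less.prems fin fin' by (subst sum.remove[of _ H]) auto
    also have "(\<Sum>X\<in>interval L H K - {H}. moebius L H X * ?\<nu> X) =
        (\<Sum>X\<in>interval L H K - {H}. if X = K then moebius L H K else 0)"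
    proof (intro sum.cong refl)
      fix X assume X: "X \<in> interval L H K - {H}"
      then have "card (K - X) < card (K - H)" using less.prems by (intro psubset_card_mono) auto
      with X have "?\<nu> X = (if X = K then 1 else 0)" using less.prems by (intro less.hyps) auto
      then show "moebius L H X * ?\<nu> X = (if X = K then moebius L H K else 0)" by simp
    qed
    also have "\<dots> = moebius L H K" using False less.prems fin by (simp add: sum.delta')
    finally show ?thesis using False by simp
  qed (use less.prems in simp)
qed

text \<open>
  Both sides run over the chains \<open>H \<subseteq> F \<subseteq> K\<close> in the interval from \<open>A\<close> to \<open>G\<close>.
\<close>

lemma sum_chain_swap:
  fixes f :: "'a set \<Rightarrow> 'a set \<Rightarrow> 'a set \<Rightarrow> 'b::comm_monoid_add"
  assumes "finite G"
  shows "(\<Sum>F\<in>interval L A G. \<Sum>H\<in>interval L A F. \<Sum>K\<in>interval L F G. f H F K) =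
    (\<Sum>H\<in>interval L A G. \<Sum>K\<in>interval L H G. \<Sum>F\<in>interval L H K. f H F K)"
proof -
  have fin: "finite (interval L X Y)" if "Y \<subseteq> G" for X Y
    using that assms finite_subset finite_interval by metis
  have "(\<Sum>F\<in>interval L A G. \<Sum>H\<in>interval L A F. \<Sum>K\<in>interval L F G. f H F K) =
      (\<Sum>(F, H, K)\<in>(SIGMA F:interval L A G. interval L A F \<times> interval L F G). f H F K)"
    using fin by (simp add: sum.Sigma sum.cartesian_product split_def)
  also have "\<dots> = (\<Sum>(H, K, F)\<in>(SIGMA H:interval L A G. SIGMA K:interval L H G. interval L H K).
      f H F K)"
    by (rule sum.reindex_bij_witness[where i = "\<lambda>(H, K, F). (F, H, K)" and j = "\<lambda>(F, H, K). (H, K, F)"])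
      (auto simp: subset_iff)
  also have "\<dots> = (\<Sum>H\<in>interval L A G. \<Sum>K\<in>interval L H G. \<Sum>F\<in>interval L H K. f H F K)"
    using fin by (subst sum.Sigma[symmetric])
      (auto simp: sum.Sigma split_def intro!: sum.cong finite_SigmaI)
  finally show ?thesis .
qed

section \<open>Reversal of polynomials in a prescribed degree\<close>

text \<open>
  For \<open>degree p \<le> n\<close> this is \<open>t\<^sup>n p(1/t)\<close>. Unlike \<open>reflect_poly\<close>, the reversal is taken in the
  prescribed degree \<open>n\<close>, which makes it additive.
\<close>

definition flip_poly :: "nat \<Rightarrow> 'a::comm_monoid_add poly \<Rightarrow> 'a poly" where
  "flip_poly n p = (\<Sum>i\<le>n. monom (coeff p i) (n - i))"

lemma coeff_flip_poly: "coeff (flip_poly n p) k = (if k \<le> n then coeff p (n - k) else 0)"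
proof -
  have "coeff (flip_poly n p) k = (\<Sum>i\<le>n. if i = n - k \<and> k \<le> n then coeff p i else 0)"
    unfolding flip_poly_def coeff_sum by (intro sum.cong refl) auto
  then show ?thesis by (auto simp: sum.delta)
qed

lemma flip_poly_0 [simp]: "flip_poly n 0 = 0"
  by (rule poly_eqI) (simp add: coeff_flip_poly)

lemma flip_poly_0_1 [simp]: "flip_poly 0 (1 :: 'a::comm_semiring_1 poly) = 1"
  by (simp add: flip_poly_def)

lemma flip_poly_diff:
  fixes p q :: "'a::ab_group_add poly"
  shows "flip_poly n (p - q) = flip_poly n p - flip_poly n q"
  by (rule poly_eqI) (simp add: coeff_flip_poly)

lemma flip_poly_sum: "flip_poly n (\<Sum>x\<in>A. f x) = (\<Sum>x\<in>A. flip_poly n (f x))"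
  by (rule poly_eqI) (simp add: coeff_flip_poly coeff_sum)

lemma flip_poly_monom: "k \<le> n \<Longrightarrow> flip_poly n (monom c k) = monom c (n - k)"
  by (rule poly_eqI) (auto simp: coeff_flip_poly)

lemma flip_poly_eq_reflect:
  fixes p :: "'a::comm_semiring_1 poly"
  shows "degree p \<le> n \<Longrightarrow> flip_poly n p = monom 1 (n - degree p) * reflect_poly p"
  by (rule poly_eqI) (auto simp: coeff_flip_poly coeff_monom_mult coeff_reflect_poly coeff_eq_0)

lemma flip_poly_mult:
  fixes p q :: "'a::idom poly"
  assumes "degree p \<le> m" "degree q \<le> n"
  shows "flip_poly (m + n) (p * q) = flip_poly m p * flip_poly n q"
proof (cases "p = 0 \<or> q = 0")
  case False
  then have "degree (p * q) = degree p + degree q" by (simp add: degree_mult_eq)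
  moreover have "monom (1::'a) (m + n - (degree p + degree q)) =
      monom 1 (m - degree p) * monom 1 (n - degree q)"
    using assms by (simp add: mult_monom)
  ultimately show ?thesis using assms
    by (simp add: flip_poly_eq_reflect reflect_poly_mult add_mono mult_ac)
qed auto

lemma flip_poly_fixed_imp_0:
  assumes "flip_poly n p = p" "2 * degree p < n"
  shows "p = 0"
proof -
  have "coeff p (degree p) = coeff p (n - degree p)"
    using assms coeff_flip_poly[of n p "degree p"] by simp
  also have "\<dots> = 0" using assms by (intro coeff_eq_0) simp
  finally show ?thesis by simp
qed

definition lower_half :: "nat \<Rightarrow> 'a::comm_monoid_add poly \<Rightarrow> 'a poly" where
  "lower_half n p = (\<Sum>i | 2 * i < n. monom (coeff p i) i)"

lemma coeff_lower_half: "coeff (lower_half n p) k = (if 2 * k < n then coeff p k else 0)"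
proof -
  have fin: "finite {i. 2 * i < n}" by (rule finite_subset[of _ "{..n}"]) auto
  have "coeff (lower_half n p) k = (\<Sum>i | 2 * i < n. if i = k then coeff p i else 0)"
    unfolding lower_half_def coeff_sum by (intro sum.cong refl) auto
  with fin show ?thesis by (auto simp: sum.delta)
qed

lemma degree_lower_half: "n > 0 \<Longrightarrow> 2 * degree (lower_half n p) < n"
proof -
  assume "n > 0"
  then have "degree (lower_half n p) \<le> (n - 1) div 2"
    by (intro degree_le) (auto simp: coeff_lower_half)
  with \<open>n > 0\<close> show ?thesis by linarith
qed

text \<open>
  Reversal exchanges the degrees below and above \<open>n / 2\<close>, so the right-hand side, which is the part
  of \<open>s\<close> in degrees at least \<open>n / 2\<close>, agrees with the left-hand side by antisymmetry, except possibly in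
  the middle degree. There antisymmetry forces the coefficient of \<open>s\<close> to equal its own negative,
  hence to vanish.
\<close>

lemma flip_lower_half:
  fixes s :: "int poly"
  assumes anti: "flip_poly n s = - s"
  shows "flip_poly n (- lower_half n s) = s + - lower_half n s"
proof (rule poly_eqI)
  fix k
  have *: "coeff s k = - (if k \<le> n then coeff s (n - k) else 0)"
    using arg_cong[OF anti, of "\<lambda>p. coeff p k"] by (simp add: coeff_flip_poly)
  consider "2 * k < n" | "2 * k = n" | "2 * k > n" by linarith
  then show "coeff (flip_poly n (- lower_half n s)) k = coeff (s + - lower_half n s) k"
  proof cases
    case 2
    then have "n - k = k" "k \<le> n" by auto
    then show ?thesis using * 2 by (simp add: coeff_flip_poly coeff_lower_half)
  qed (use * in \<open>auto simp: coeff_flip_poly coeff_lower_half\<close>)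
qed

abbreviation rat_poly :: "int poly \<Rightarrow> rat poly" where
  "rat_poly \<equiv> map_poly of_int"

lemma rat_poly_mult: "rat_poly (p * q) = rat_poly p * rat_poly q"
  by (rule poly_eqI) (simp add: coeff_map_poly coeff_mult)

lemma rat_poly_sum: "rat_poly (\<Sum>x\<in>A. f x) = (\<Sum>x\<in>A. rat_poly (f x))"
  by (rule poly_eqI) (simp add: coeff_map_poly coeff_sum)

lemma poly_rat_poly_flip:
  assumes "degree p \<le> n" "t \<noteq> 0"
  shows "poly (rat_poly (flip_poly n p)) t = t ^ n * poly (rat_poly p) (inverse t)"
proof -
  have "poly (rat_poly (flip_poly n p)) t = (\<Sum>i\<le>n. of_int (coeff p i) * t ^ (n - i))"
    unfolding flip_poly_def rat_poly_sum
    by (simp add: poly_sum map_poly_monom poly_monom)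
  also have "\<dots> = (\<Sum>i\<le>n. t ^ n * (of_int (coeff p i) * inverse t ^ i))"
    using assms by (intro sum.cong refl) (simp add: power_diff field_simps)
  also have "\<dots> = t ^ n * poly (rat_poly p) (inverse t)"
  proof -
    have "coeff p k = 0" if "\<not> k \<le> n" for k
      using that assms by (intro coeff_eq_0) simp
    then have "rat_poly p = (\<Sum>i\<le>n. monom (of_int (coeff p i)) i)"
      by (intro poly_eqI) (simp add: coeff_map_poly coeff_sum)
    then show ?thesis by (simp add: poly_sum poly_monom sum_distrib_left)
  qed
  finally show ?thesis .
qed

lemma rat_poly_eqI:
  assumes "\<And>t::rat. t \<noteq> 0 \<Longrightarrow> poly (rat_poly p) t = poly (rat_poly q) t"
  shows "p = q"
proof -
  have "rat_poly p - rat_poly q = 0"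
  proof (rule ccontr)
    assume "rat_poly p - rat_poly q \<noteq> 0"
    then have "finite {t. poly (rat_poly p - rat_poly q) t = 0}" by (rule poly_roots_finite)
    moreover have "- {0} \<subseteq> {t. poly (rat_poly p - rat_poly q) t = 0}" using assms by auto
    ultimately have "finite (- {0::rat})" by (rule finite_subset[rotated])
    then show False using infinite_UNIV_char_0[where 'a = rat] by (simp add: Compl_eq_Diff_UNIV)
  qed
  then have "coeff (rat_poly p) k = coeff (rat_poly q) k" for k by simp
  then show ?thesis by (intro poly_eqI) (simp add: coeff_map_poly)
qed

section \<open>Characteristic polynomials of intervals of flats\<close>

text \<open>
  The characteristic polynomial of the minor of \<open>M\<close> obtained by contracting \<open>F\<close> and restricting to
  \<open>G\<close>, computed inside the lattice of flats of \<open>M\<close>.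
\<close>

definition interval_poly :: "'a matroid \<Rightarrow> 'a set \<Rightarrow> 'a set \<Rightarrow> int poly" where
  "interval_poly M F G =
    (\<Sum>H\<in>interval (flats M) F G.
      monom (moebius (flats M) F H) (rank_of M G - rank_of M H))"

context loopless_matroid
begin

text \<open>
  Removing \<open>F\<close> is an isomorphism from the interval between \<open>F\<close> and \<open>G\<close> onto the flats of the minor;
  it shifts ranks by the rank of \<open>F\<close> and preserves the Moebius function.
\<close>

lemma char_poly_interval:
  assumes F: "F \<in> flats M" and G: "G \<in> flats M" and FG: "F \<subseteq> G"
  shows "char_poly (localization (contraction M F) (G - F)) = interval_poly M F G"
proof -
  let ?L = "flats M" and ?N = "contraction M F"
  let ?L' = "flats (localization ?N (G - F))"
  interpret C: loopless_matroid ?N by (rule contraction_loopless[OF F])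
  have G': "G - F \<in> flats ?N" using F G FG flats_contraction flat_subset by auto
  have L': "?L' = (\<lambda>X. X - F) ` interval ?L F G"
  proof -
    have "X - F \<subseteq> G - F \<longleftrightarrow> X \<subseteq> G" for X using FG by blast
    then show ?thesis
      unfolding C.flats_localization[OF G'] flats_contraction[OF flat_subset[OF F]]
      by (auto simp: interval_def)
  qed
  have inj: "inj_on (\<lambda>X. X - F) (interval ?L F K)" for K
    by (rule inj_onI) (metis Diff_partition mem_interval)
  have rank: "rank_of ?N (X - F) = rank_of M X - rank_of M F" if "X \<in> ?L" "F \<subseteq> X" for X
  proof -
    have "X - F \<subseteq> ground M - F" "X - F \<union> F = X" using that flat_subset by auto
    then show ?thesis using rank_contraction[of "X - F" F] by simp
  qed
  have mu: "moebius ?L F H = moebius ?L' {} (H - F)" if H: "H \<in> interval ?L F G" for H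
  proof (rule moebius_unique[of _ _ _ "\<lambda>H. moebius ?L' {} (H - F)"])
    fix K assume K: "K \<in> interval ?L F H"
    have "interval ?L' {} (K - F) = (\<lambda>X. X - F) ` interval ?L F K"
    proof -
      have "X - F \<subseteq> K - F \<longleftrightarrow> X \<subseteq> K" for X using K by auto
      moreover have "interval ?L F K = {X \<in> interval ?L F G. X \<subseteq> K}"
        using K H unfolding interval_def by blast
      ultimately show ?thesis unfolding L' by (auto simp del: mem_interval simp: interval_def[of "_ ` _"])
    qed
    then have "(\<Sum>X\<in>interval ?L F K. moebius ?L' {} (X - F)) =
        (\<Sum>Y\<in>interval ?L' {} (K - F). moebius ?L' {} Y)"
      by (simp add: sum.reindex[OF inj])
    also have "\<dots> = (if {} = K - F then 1 else 0)"
    proof (rule sum_moebius)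
      show "{} \<in> ?L'" using F FG L' by force
      show "K - F \<in> ?L'" using K H L' by auto
      show "finite (K - F)" using K finite_flat by auto
    qed auto
    also have "{} = K - F \<longleftrightarrow> F = K" using K by auto
    finally show "(\<Sum>X\<in>interval ?L F K. moebius ?L' {} (X - F)) = (if F = K then 1 else 0)" .
  qed (use H F finite_flat in auto)
  show ?thesis
    unfolding char_poly_def interval_poly_def L' sum.reindex[OF inj]
  proof (intro sum.cong refl, unfold o_def)
    fix H assume H: "H \<in> interval ?L F G"
    have "rank_of (localization ?N (G - F)) (H - F) = rank_of M H - rank_of M F"
      using H rank by (subst C.rank_localization) auto
    moreover have "rk (localization ?N (G - F)) = rank_of M G - rank_of M F"
      using G FG rank by simp
    moreover have "rank_of M F \<le> rank_of M H" using H by (auto intro: rank_mono)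
    ultimately show "monom (moebius ((\<lambda>X. X - F) ` interval ?L F G) {} (H - F))
        (rk (localization ?N (G - F)) - rank_of (localization ?N (G - F)) (H - F)) =
        monom (moebius ?L F H) (rank_of M G - rank_of M H)"
      using mu[OF H] unfolding L' by simp
  qed
qed

lemma char_poly_localization:
  "F \<in> flats M \<Longrightarrow> char_poly (localization M F) = interval_poly M {} F"
  using char_poly_interval[OF empty_flat, of F] by simp

lemma interval_poly_self: "F \<in> flats M \<Longrightarrow> interval_poly M F F = 1"
  by (simp add: interval_poly_def finite_flat)

lemma degree_interval_poly: "degree (interval_poly M {} F) \<le> rank_of M F"
  unfolding interval_poly_def
proof (rule degree_sum_le)
  show "finite (interval (flats M) {} F)"
    using finite_flats by (rule finite_subset[rotated]) auto
  show "degree (monom (moebius (flats M) {} H) (rank_of M F - rank_of M H)) \<le> rank_of M F" for H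
    using degree_monom_le diff_le_self order_trans by blast
qed

lemma flip_interval_poly:
  assumes F: "F \<in> flats M"
  shows "flip_poly (rank_of M F) (interval_poly M {} F) =
    (\<Sum>H\<in>interval (flats M) {} F. monom (moebius (flats M) {} H) (rank_of M H))"
  unfolding interval_poly_def flip_poly_sum
  using rank_mono by (intro sum.cong refl) (simp add: flip_poly_monom)

text \<open>
  Expanding both factors gives a sum over chains \<open>H \<subseteq> F \<subseteq> K\<close> below \<open>G\<close> of
  \<open>\<mu>(0, H) \<mu>(F, K) t\<^bsup>r(H) + r(G) - r(K)\<^esup>\<close>. Summing over \<open>F\<close> first leaves only \<open>H = K\<close>, where the
  exponent is constantly \<open>r(G)\<close>; the remaining sum of \<open>\<mu>(0, H)\<close> over all flats \<open>H \<subseteq> G\<close> is zero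
  because \<open>G\<close> is nonempty.
\<close>

lemma kernel_identity:
  assumes G: "G \<in> flats M" and ne: "G \<noteq> {}"
  shows "(\<Sum>F\<in>interval (flats M) {} G.
      flip_poly (rank_of M F) (interval_poly M {} F) * interval_poly M F G) = 0"
proof -
  let ?L = "flats M" and ?r = "rank_of M"
  have finG: "finite G" using G finite_flat by auto
  have "(\<Sum>F\<in>interval ?L {} G. flip_poly (?r F) (interval_poly M {} F) * interval_poly M F G) =
    (\<Sum>F\<in>interval ?L {} G. \<Sum>H\<in>interval ?L {} F. \<Sum>K\<in>interval ?L F G.
      monom (moebius ?L {} H * moebius ?L F K) (?r H + (?r G - ?r K)))"
    by (intro sum.cong refl)
      (simp add: flip_interval_poly, simp add: interval_poly_def sum_product mult_monom)
  also have "\<dots> = (\<Sum>H\<in>interval ?L {} G. \<Sum>K\<in>interval ?L H G. \<Sum>F\<in>interval ?L H K.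
      monom (moebius ?L {} H * moebius ?L F K) (?r H + (?r G - ?r K)))"
    by (rule sum_chain_swap[OF finG])
  also have "\<dots> = (\<Sum>H\<in>interval ?L {} G. \<Sum>K\<in>interval ?L H G.
      if H = K then monom (moebius ?L {} H) (?r G) else 0)"
  proof (intro sum.cong refl)
    fix H K assume H: "H \<in> interval ?L {} G" and K: "K \<in> interval ?L H G"
    have "(\<Sum>F\<in>interval ?L H K.
        monom (moebius ?L {} H * moebius ?L F K) (?r H + (?r G - ?r K))) =
      monom (moebius ?L {} H * (\<Sum>F\<in>interval ?L H K. moebius ?L F K)) (?r H + (?r G - ?r K))"
      by (simp add: monom_sum sum_distrib_left)
    also have "(\<Sum>F\<in>interval ?L H K. moebius ?L F K) = (if H = K then 1 else 0)"
      using H K finite_flat by (intro sum_moebius_dual) auto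
    finally show "(\<Sum>F\<in>interval ?L H K.
        monom (moebius ?L {} H * moebius ?L F K) (?r H + (?r G - ?r K))) =
      (if H = K then monom (moebius ?L {} H) (?r G) else 0)"
      using H rank_mono[of H G] by auto
  qed
  also have "\<dots> = monom (\<Sum>H\<in>interval ?L {} G. moebius ?L {} H) (?r G)"
    using finite_interval[OF finG, of ?L] by (auto simp: monom_sum sum.delta intro!: sum.cong)
  also have "\<dots> = 0"
    using sum_moebius[OF empty_flat G finG] ne by simp
  finally show ?thesis .
qed

end

section \<open>Existence and uniqueness of Kazhdan--Lusztig polynomials\<close>

text \<open>
  The defining conditions of the Kazhdan--Lusztig polynomials at one matroid, with the functional
  equation stated as an identity of integer polynomials instead of evaluations at rationals.
\<close>

definition KL_at :: "('a matroid \<Rightarrow> int poly) \<Rightarrow> 'a matroid \<Rightarrow> bool" where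
  "KL_at P M \<longleftrightarrow>
    (rk M = 0 \<longrightarrow> P M = 1) \<and>
    (rk M > 0 \<longrightarrow> 2 * degree (P M) < rk M) \<and>
    flip_poly (rk M) (P M) =
      (\<Sum>F\<in>flats M. char_poly (localization M F) * P (contraction M F))"

lemma KL_at_degree: "KL_at P M \<Longrightarrow> degree (P M) \<le> rk M"
  unfolding KL_at_def by (cases "rk M") auto

text \<open>
  The degree conditions make \<open>t\<^bsup>rk M\<^esup> P(1/t)\<close> a polynomial, and polynomials that agree at all
  nonzero rationals are equal.
\<close>

lemma is_KL_family_iff:
  "is_KL_family P \<longleftrightarrow>
    P \<in> extensional {M. loopless_matroid M} \<and> (\<forall>M. loopless_matroid M \<longrightarrow> KL_at P M)"
proof -
  have eval: "(\<forall>t::rat. t \<noteq> 0 \<longrightarrow>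
        t ^ rk M * poly (rat_poly (P M)) (inverse t) =
        (\<Sum>F\<in>flats M. poly (rat_poly (char_poly (localization M F))) t *
                       poly (rat_poly (P (contraction M F))) t)) \<longleftrightarrow>
      flip_poly (rk M) (P M) =
        (\<Sum>F\<in>flats M. char_poly (localization M F) * P (contraction M F))"
    (is "?eval M \<longleftrightarrow> ?poly")
    if deg: "degree (P M) \<le> rk M" for M
  proof -
    let ?S = "\<Sum>F\<in>flats M. char_poly (localization M F) * P (contraction M F)"
    have "?eval M \<longleftrightarrow> (\<forall>t::rat. t \<noteq> 0 \<longrightarrow>
        poly (rat_poly (flip_poly (rk M) (P M))) t = poly (rat_poly ?S) t)"
      using deg by (simp add: poly_rat_poly_flip rat_poly_sum rat_poly_mult poly_sum)
    also have "\<dots> \<longleftrightarrow> ?poly" using rat_poly_eqI by metis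
    finally show ?thesis .
  qed
  have *: "(rk M = 0 \<longrightarrow> P M = 1) \<and> (rk M > 0 \<longrightarrow> 2 * degree (P M) < rk M) \<and> ?eval M \<longleftrightarrow>
      KL_at P M" for M
  proof (cases "degree (P M) \<le> rk M")
    case True
    show ?thesis unfolding KL_at_def eval[OF True] ..
  next
    case False
    then have "rk M \<noteq> 0 \<or> P M \<noteq> 1" "\<not> 2 * degree (P M) < rk M" by auto
    then show ?thesis unfolding KL_at_def by (meson gr0I)
  qed
  show ?thesis unfolding is_KL_family_def * ..
qed

text \<open>
  The difference of two solutions with the same remainder \<open>s\<close> is fixed by reversal in degree \<open>n\<close>
  and lives below the middle degree.
\<close>

lemma KL_step_unique:
  fixes p q s :: "int poly"
  assumes P: "n > 0 \<Longrightarrow> 2 * degree p < n" and Q: "n > 0 \<Longrightarrow> 2 * degree q < n"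
    and "n = 0 \<Longrightarrow> p = q"
    and "flip_poly (n) p = p + s" "flip_poly (n) q = q + s"
  shows "p = q"
proof (cases "n = 0")
  case False
  have "2 * degree (p - q) < n"
    using False P Q degree_diff_le_max[of p q] by linarith
  moreover have "flip_poly (n) (p - q) = p - q" using assms by (simp add: flip_poly_diff)
  ultimately show ?thesis using flip_poly_fixed_imp_0 by fastforce
qed (use assms in simp)

text \<open>
  The only possible choice: in degrees below \<open>rk M / 2\<close> the left-hand side of
  \<open>flip_poly (rk M) P = P + S\<close> vanishes, so \<open>P\<close> agrees there with \<open>- S\<close>. The recursion runs over all
  matroid records, and the test for an infinite ground set serves termination.
\<close>

function kl :: "'a matroid \<Rightarrow> int poly" where
  "kl M =
    (if rk M = 0 \<or> infinite (ground M) then 1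
     else - lower_half (rk M)
       (\<Sum>F\<in>flats M - {{}}. char_poly (localization M F) * kl (contraction M F)))"
  by pat_completeness auto
termination
proof (relation "measure (\<lambda>M. card (ground M))")
  fix M :: "'a matroid" and F
  assume "\<not> (rk M = 0 \<or> infinite (ground M))" "F \<in> flats M - {{}}"
  then show "(contraction M F, M) \<in> measure (\<lambda>M. card (ground M))"
    by (auto simp: contraction_def flats_def intro!: psubset_card_mono)
qed simp

declare kl.simps [simp del]

context loopless_matroid
begin

lemma rk_eq_0_iff: "rk M = 0 \<longleftrightarrow> ground M = {}"
  unfolding rk_def using rank_pos[of "ground M"] by (metis less_irrefl order_refl rank_empty)

lemma card_ground_contraction:
  "F \<in> flats M \<Longrightarrow> F \<noteq> {} \<Longrightarrow> card (ground (contraction M F)) < card (ground M)"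
  using flat_subset finite_ground by (auto intro!: psubset_card_mono)

lemma char_poly_empty [simp]: "char_poly (localization M {}) = 1"
  using char_poly_localization[OF empty_flat] interval_poly_self[OF empty_flat] by simp

lemma KL_sum_split:
  "(\<Sum>F\<in>flats M. char_poly (localization M F) * P (contraction M F)) =
    P M + (\<Sum>F\<in>flats M - {{}}. char_poly (localization M F) * P (contraction M F))"
  by (subst sum.remove[OF finite_flats empty_flat]) simp

lemma sum_flats_contraction:
  assumes F: "F \<in> flats M"
  shows "(\<Sum>H\<in>flats (contraction M F). f H) = (\<Sum>G\<in>{G \<in> flats M. F \<subseteq> G}. f (G - F))"
proof -
  have "inj_on (\<lambda>G. G - F) {G \<in> flats M. F \<subseteq> G}"
    by (rule inj_onI) (metis (mono_tags, lifting) Diff_partition mem_Collect_eq)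
  then show ?thesis
    unfolding flats_contraction[OF flat_subset[OF F]] by (simp add: sum.reindex)
qed

text \<open>
  Reversing a summand reverses both factors, and the functional equation of the contraction at \<open>F\<close>
  expands the second one over the flats \<open>G \<supseteq> F\<close>. Collecting the terms for fixed \<open>G\<close>, the kernel
  identity says that the sum over nonempty \<open>F \<subseteq> G\<close> is the negative of the term for \<open>F = {}\<close>, which is
  the characteristic polynomial of the localization at \<open>G\<close>.
\<close>

lemma flip_lower_sum:
  assumes KL: "\<And>F. F \<in> flats M \<Longrightarrow> F \<noteq> {} \<Longrightarrow> KL_at P (contraction M F)"
  defines "S \<equiv> \<Sum>F\<in>flats M - {{}}. char_poly (localization M F) * P (contraction M F)"
  shows "flip_poly (rk M) S = - S"
proof -
  let ?L = "flats M" and ?L' = "flats M - {{}}"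
  have fin: "finite ?L" by (rule finite_flats)
  have "flip_poly (rk M) S =
      (\<Sum>F\<in>?L'. \<Sum>G\<in>{G \<in> ?L'. F \<subseteq> G}. flip_poly (rank_of M F) (interval_poly M {} F) *
        (interval_poly M F G * P (contraction M G)))"
    unfolding S_def flip_poly_sum
  proof (intro sum.cong refl)
    fix F assume F: "F \<in> ?L'"
    then have sub: "F \<subseteq> ground M" using flat_subset by auto
    have rk: "rk M = rank_of M F + rk (contraction M F)"
      using rk_contraction[OF sub] rank_mono[OF sub] by (simp add: rk_def)
    have "flip_poly (rk M) (char_poly (localization M F) * P (contraction M F)) =
        flip_poly (rank_of M F) (interval_poly M {} F) *
        flip_poly (rk (contraction M F)) (P (contraction M F))"
      unfolding rk using F KL
      by (subst flip_poly_mult) (auto simp: char_poly_localization degree_interval_poly KL_at_degree)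
    also have "flip_poly (rk (contraction M F)) (P (contraction M F)) =
        (\<Sum>G\<in>{G \<in> ?L. F \<subseteq> G}. char_poly (localization (contraction M F) (G - F)) *
          P (contraction (contraction M F) (G - F)))"
      using KL F by (simp add: KL_at_def sum_flats_contraction)
    also have "\<dots> = (\<Sum>G\<in>{G \<in> ?L'. F \<subseteq> G}. interval_poly M F G * P (contraction M G))"
      using F by (intro sum.cong) (auto simp: char_poly_interval contraction_contraction)
    finally show "flip_poly (rk M) (char_poly (localization M F) * P (contraction M F)) =
        (\<Sum>G\<in>{G \<in> ?L'. F \<subseteq> G}. flip_poly (rank_of M F) (interval_poly M {} F) *
          (interval_poly M F G * P (contraction M G)))"
      by (simp add: sum_distrib_left)
  qed
  also have "\<dots> = (\<Sum>G\<in>?L'. \<Sum>F\<in>{F \<in> ?L'. F \<subseteq> G}.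
      flip_poly (rank_of M F) (interval_poly M {} F) *
        (interval_poly M F G * P (contraction M G)))"
    using fin by (intro sum.swap_restrict) auto
  also have "\<dots> = (\<Sum>G\<in>?L'. - (interval_poly M {} G * P (contraction M G)))"
  proof (intro sum.cong refl)
    fix G assume G: "G \<in> ?L'"
    let ?k = "\<lambda>F. flip_poly (rank_of M F) (interval_poly M {} F) * interval_poly M F G"
    have "interval ?L {} G - {{}} = {F \<in> ?L'. F \<subseteq> G}" by auto
    moreover have "finite (interval ?L {} G)" using G finite_flat finite_interval by auto
    moreover have "?k {} = interval_poly M {} G"
      by (simp add: interval_poly_self[OF empty_flat])
    ultimately have "(\<Sum>F\<in>{F \<in> ?L'. F \<subseteq> G}. ?k F) = - interval_poly M {} G"
      using kernel_identity[of G] G empty_flat sum.remove[of "interval ?L {} G" "{}" ?k]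
      by (simp only: eq_neg_iff_add_eq_0 add.commute) simp
    then have "(\<Sum>F\<in>{F \<in> ?L'. F \<subseteq> G}. ?k F) * P (contraction M G) =
        - (interval_poly M {} G * P (contraction M G))" by simp
    then show "(\<Sum>F\<in>{F \<in> ?L'. F \<subseteq> G}. flip_poly (rank_of M F) (interval_poly M {} F) *
        (interval_poly M F G * P (contraction M G))) =
        - (interval_poly M {} G * P (contraction M G))"
      by (simp add: sum_distrib_right mult.assoc)
  qed
  also have "\<dots> = - S"
    unfolding S_def sum_negf by (simp add: char_poly_localization)
  finally show ?thesis .
qed

end

lemma KL_at_kl: "loopless_matroid M \<Longrightarrow> KL_at kl M"
proof (induction "card (ground M)" arbitrary: M rule: less_induct)
  case less
  interpret loopless_matroid M by fact
  let ?S = "\<Sum>F\<in>flats M - {{}}. char_poly (localization M F) * kl (contraction M F)"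
  have IH: "KL_at kl (contraction M F)" if "F \<in> flats M" "F \<noteq> {}" for F
    using less.hyps[OF card_ground_contraction contraction_loopless] that by simp
  have eq: "(\<Sum>F\<in>flats M. char_poly (localization M F) * kl (contraction M F)) = kl M + ?S"
    by (rule KL_sum_split)
  show ?case
  proof (cases "rk M = 0")
    case True
    then have "flats M - {{}} = {}" using rk_eq_0_iff flat_subset by auto
    then have "?S = 0" by (simp only: sum.empty)
    moreover have "kl M = 1" using True by (simp add: kl.simps)
    ultimately show ?thesis using True eq unfolding KL_at_def by simp
  next
    case False
    then have kl: "kl M = - lower_half (rk M) ?S" using finite_ground by (subst kl.simps) simp
    have "flip_poly (rk M) (kl M) = ?S + kl M"
      unfolding kl by (rule flip_lower_half[OF flip_lower_sum[OF IH]])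
    moreover have "2 * degree (kl M) < rk M" using False kl degree_lower_half by simp
    ultimately show ?thesis using False eq unfolding KL_at_def by (simp add: add.commute)
  qed
qed

lemma KL_at_unique:
  assumes P: "\<And>M. loopless_matroid M \<Longrightarrow> KL_at P M"
    and Q: "\<And>M. loopless_matroid M \<Longrightarrow> KL_at Q M"
  shows "loopless_matroid M \<Longrightarrow> P M = Q M"
proof (induction "card (ground M)" arbitrary: M rule: less_induct)
  case less
  interpret loopless_matroid M by fact
  let ?S = "\<lambda>P. \<Sum>F\<in>flats M - {{}}. char_poly (localization M F) * P (contraction M F)"
  have "P (contraction M F) = Q (contraction M F)" if "F \<in> flats M" "F \<noteq> {}" for F
    using less.hyps[OF card_ground_contraction contraction_loopless] that by simp
  then have "?S P = ?S Q" by (intro sum.cong refl) simp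
  moreover have "flip_poly (rk M) (P M) = P M + ?S P" "flip_poly (rk M) (Q M) = Q M + ?S Q"
    using P[OF less.prems] Q[OF less.prems] unfolding KL_at_def KL_sum_split by blast+
  ultimately show ?case
    using KL_step_unique[of "rk M" "P M" "Q M" "?S P"] P[OF less.prems] Q[OF less.prems]
    unfolding KL_at_def by argo
qed

text \<open>
  Existence and uniqueness together justify the definite description. Restricting \<open>kl\<close> to loopless
  matroids supplies the extensionality that uniqueness on the whole type requires; the contractions
  at flats are loopless again, so the restriction does not affect the functional equations.
\<close>

lemma KL_at_KL_poly:
  assumes "loopless_matroid M"
  shows "KL_at KL_poly M"
proof -
  let ?K = "restrict kl {M. loopless_matroid M} :: 'a matroid \<Rightarrow> int poly"
  have "KL_at ?K M" if M: "loopless_matroid M" for M :: "'a matroid"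
  proof -
    have "?K (contraction M F) = kl (contraction M F)" if "F \<in> flats M" for F
      using loopless_matroid.contraction_loopless[OF M that] by simp
    then show ?thesis using KL_at_kl[OF M] M unfolding KL_at_def by simp
  qed
  then have K: "is_KL_family ?K" by (simp add: is_KL_family_iff)
  have "is_KL_family (KL_poly :: 'a matroid \<Rightarrow> int poly)"
    unfolding KL_poly_def
  proof (rule theI[of is_KL_family, OF K])
    fix P :: "'a matroid \<Rightarrow> int poly" assume P: "is_KL_family P"
    show "P = ?K"
    proof (rule extensionalityI)
      fix M :: "'a matroid" assume "M \<in> {M. loopless_matroid M}"
      then show "P M = ?K M" using P K KL_at_unique[of P ?K] unfolding is_KL_family_iff by blast
    next
      show "P \<in> extensional {M. loopless_matroid M}" using P by (simp only: is_KL_family_iff)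
    qed simp
  qed
  then show ?thesis using assms by (simp add: is_KL_family_iff)
qed

section \<open>Direct sums\<close>

lemma Plus_cases:
  fixes X :: "('a + 'b) set"
  obtains A B where "X = A <+> B"
proof
  show "X = Inl -` X <+> Inr -` X"
  proof (rule set_eqI)
    show "x \<in> X \<longleftrightarrow> x \<in> Inl -` X <+> Inr -` X" for x by (cases x) auto
  qed
qed

lemma Plus_subset_iff: "A <+> B \<subseteq> C <+> D \<longleftrightarrow> A \<subseteq> C \<and> B \<subseteq> D"
  by auto

lemma Plus_eq_iff: "A <+> B = C <+> D \<longleftrightarrow> A = C \<and> B = D"
  using Plus_subset_iff by (metis subset_antisym order_refl)

locale two_matroids = M1: loopless_matroid M1 + M2: loopless_matroid M2
  for M1 :: "'a matroid" and M2 :: "'b matroid"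
begin

abbreviation M where "M \<equiv> direct_sum M1 M2"

lemma ground_direct_sum: "ground M = ground M1 <+> ground M2"
  by (simp add: direct_sum_def)

lemma indep_direct_sum: "I <+> J \<in> indeps M \<longleftrightarrow> I \<in> indeps M1 \<and> J \<in> indeps M2"
  by (auto simp: direct_sum_def Plus_eq_iff)

lemma direct_sum_loopless: "loopless_matroid M"
proof
  show "finite (ground M)"
    using M1.finite_ground M2.finite_ground by (simp add: ground_direct_sum)
  show "I \<subseteq> ground M" if "I \<in> indeps M" for I
    using that M1.indeps_ground M2.indeps_ground by (auto simp: direct_sum_def)
  show "{} \<in> indeps M"
    using indep_direct_sum[of "{}" "{}"] M1.indeps_empty M2.indeps_empty by (simp add: Plus_def)
  show "J \<in> indeps M" if "I \<in> indeps M" "J \<subseteq> I" for I J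
  proof -
    obtain J1 J2 where J: "J = J1 <+> J2" by (rule Plus_cases)
    obtain I1 I2 where I: "I = I1 <+> I2" by (rule Plus_cases)
    show ?thesis
      using that M1.indeps_subset M2.indeps_subset
      unfolding I J indep_direct_sum Plus_subset_iff by blast
  qed
  show "{e} \<in> indeps M" if "e \<in> ground M" for e
  proof (cases e)
    case (Inl a)
    then have "{e} = {a} <+> {}" by auto
    then show ?thesis
      using that Inl M1.loopless M2.indeps_empty indep_direct_sum by (auto simp: ground_direct_sum)
  next
    case (Inr b)
    then have "{e} = {} <+> {b}" by auto
    then show ?thesis
      using that Inr M2.loopless M1.indeps_empty indep_direct_sum by (auto simp: ground_direct_sum)
  qed
  show "\<exists>e\<in>J - I. insert e I \<in> indeps M"
    if ind: "I \<in> indeps M" "J \<in> indeps M" and lt: "card I < card J" for I J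
  proof -
    obtain J1 J2 where J: "J = J1 <+> J2" by (rule Plus_cases)
    obtain I1 I2 where I: "I = I1 <+> I2" by (rule Plus_cases)
    note IJ = I J
    then have ind': "I1 \<in> indeps M1" "J1 \<in> indeps M1" "I2 \<in> indeps M2" "J2 \<in> indeps M2"
      using ind indep_direct_sum by auto
    then have "card I1 + card I2 < card J1 + card J2"
      using lt IJ M1.finite_indep M2.finite_indep by (simp add: card_Plus)
    then consider "card I1 < card J1" | "card I2 < card J2" by linarith
    then show ?thesis
    proof cases
      case 1
      then obtain e where e: "e \<in> J1 - I1" "insert e I1 \<in> indeps M1"
        using M1.indeps_augment ind' by blast
      moreover have "insert (Inl e) I = insert e I1 <+> I2" using IJ by auto
      ultimately show ?thesis
        using IJ ind' indep_direct_sum by (intro bexI[of _ "Inl e"]) auto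
    next
      case 2
      then obtain e where e: "e \<in> J2 - I2" "insert e I2 \<in> indeps M2"
        using M2.indeps_augment ind' by blast
      moreover have "insert (Inr e) I = I1 <+> insert e I2" using IJ by auto
      ultimately show ?thesis
        using IJ ind' indep_direct_sum by (intro bexI[of _ "Inr e"]) auto
    qed
  qed
qed

sublocale M: loopless_matroid M
  by (rule direct_sum_loopless)

lemma rank_direct_sum: "rank_of M (X <+> Y) = rank_of M1 X + rank_of M2 Y"
proof (rule antisym)
  obtain I where I: "I \<in> indeps M" "I \<subseteq> X <+> Y" "card I = rank_of M (X <+> Y)"
    using M.rank_attained by blast
  obtain I1 I2 where "I = I1 <+> I2" by (rule Plus_cases)
  with I show "rank_of M (X <+> Y) \<le> rank_of M1 X + rank_of M2 Y"
    using M1.indep_card_le_rank[of I1 X] M2.indep_card_le_rank[of I2 Y]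
    by (simp add: indep_direct_sum Plus_subset_iff card_Plus M1.finite_indep M2.finite_indep
        add_mono)
next
  obtain I1 where I1: "I1 \<in> indeps M1" "I1 \<subseteq> X" "card I1 = rank_of M1 X"
    using M1.rank_attained by blast
  obtain I2 where I2: "I2 \<in> indeps M2" "I2 \<subseteq> Y" "card I2 = rank_of M2 Y"
    using M2.rank_attained by blast
  show "rank_of M1 X + rank_of M2 Y \<le> rank_of M (X <+> Y)"
    using M.indep_card_le_rank[of "I1 <+> I2" "X <+> Y"] I1 I2
    by (simp add: indep_direct_sum Plus_subset_iff card_Plus M1.finite_indep M2.finite_indep)
qed

lemma rk_direct_sum: "rk M = rk M1 + rk M2"
  by (simp add: rk_def ground_direct_sum rank_direct_sum)

lemma flat_direct_sum: "F1 <+> F2 \<in> flats M \<longleftrightarrow> F1 \<in> flats M1 \<and> F2 \<in> flats M2"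
proof -
  have ins: "insert (Inl a) (F1 <+> F2) = insert a F1 <+> F2"
    "insert (Inr b) (F1 <+> F2) = F1 <+> insert b F2" for a b by auto
  have diff: "ground M1 <+> ground M2 - (F1 <+> F2) = (ground M1 - F1) <+> (ground M2 - F2)"
    by auto
  have ball: "(\<forall>e\<in>A <+> B. Q e) \<longleftrightarrow> (\<forall>a\<in>A. Q (Inl a)) \<and> (\<forall>b\<in>B. Q (Inr b))"
    for A :: "'a set" and B :: "'b set" and Q
    by auto
  show ?thesis
    unfolding flats_def ground_direct_sum mem_Collect_eq Plus_subset_iff diff ball ins
      rank_direct_sum by auto
qed

lemma sum_flats_direct_sum:
  "(\<Sum>F\<in>flats M. f F) = (\<Sum>F1\<in>flats M1. \<Sum>F2\<in>flats M2. f (F1 <+> F2))"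
proof -
  have "flats M = (\<lambda>(F1, F2). F1 <+> F2) ` (flats M1 \<times> flats M2)"
    (is "?L = ?R")
  proof (intro equalityI subsetI)
    fix F assume F: "F \<in> ?L"
    obtain F1 F2 where "F = F1 <+> F2" by (rule Plus_cases)
    with F show "F \<in> ?R" by (auto simp: flat_direct_sum intro!: image_eqI[of _ _ "(F1, F2)"])
  qed (auto simp: flat_direct_sum)
  moreover have "inj_on (\<lambda>(F1, F2). F1 <+> F2) (flats M1 \<times> flats M2)"
    by (auto simp: inj_on_def Plus_eq_iff)
  ultimately show ?thesis by (simp add: sum.reindex sum.cartesian_product split_def)
qed

lemma sum_interval_direct_sum:
  "(\<Sum>F\<in>interval (flats M) {} (G1 <+> G2). f F) =
    (\<Sum>F1\<in>interval (flats M1) {} G1. \<Sum>F2\<in>interval (flats M2) {} G2. f (F1 <+> F2))"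
proof -
  have "interval (flats M) {} (G1 <+> G2) =
      (\<lambda>(F1, F2). F1 <+> F2) ` (interval (flats M1) {} G1 \<times> interval (flats M2) {} G2)"
    (is "?I = ?J")
  proof (intro equalityI subsetI)
    fix F assume F: "F \<in> ?I"
    obtain F1 F2 where "F = F1 <+> F2" by (rule Plus_cases)
    with F show "F \<in> ?J"
      by (auto simp: flat_direct_sum Plus_subset_iff intro!: image_eqI[of _ _ "(F1, F2)"])
  qed (auto simp: flat_direct_sum Plus_subset_iff)
  moreover have "inj_on (\<lambda>(F1, F2). F1 <+> F2)
      (interval (flats M1) {} G1 \<times> interval (flats M2) {} G2)"
    by (auto simp: inj_on_def Plus_eq_iff)
  ultimately show ?thesis by (simp add: sum.reindex sum.cartesian_product split_def)
qed

text \<open>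
  Sums over an interval of the product lattice factor, so the product of the two Moebius functions
  has the interval sums that characterize the Moebius function of the direct sum.
\<close>

lemma moebius_direct_sum:
  assumes "G1 \<in> flats M1" "G2 \<in> flats M2"
  shows "moebius (flats M) {} (G1 <+> G2) =
    moebius (flats M1) {} G1 * moebius (flats M2) {} G2"
proof -
  let ?g = "\<lambda>H. moebius (flats M1) {} (Inl -` H) * moebius (flats M2) {} (Inr -` H)"
  have vim: "Inl -` (A <+> B) = A" "Inr -` (A <+> B) = B" for A :: "'a set" and B :: "'b set"
    by auto
  have "moebius (flats M) {} (G1 <+> G2) = ?g (G1 <+> G2)"
  proof (rule moebius_unique)
    show "G1 <+> G2 \<in> flats M" using assms flat_direct_sum by simp
    then show "finite (G1 <+> G2)" by (rule M.finite_flat)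
    show "(\<Sum>H\<in>interval (flats M) {} K. ?g H) = (if {} = K then 1 else 0)"
      if "K \<in> interval (flats M) {} (G1 <+> G2)" for K
    proof -
      obtain K1 K2 where K: "K = K1 <+> K2" by (rule Plus_cases)
      then have K': "K1 \<in> flats M1" "K2 \<in> flats M2" using that flat_direct_sum by auto
      have "(\<Sum>H\<in>interval (flats M) {} K. ?g H) =
          (\<Sum>H\<in>interval (flats M1) {} K1. moebius (flats M1) {} H) *
          (\<Sum>H\<in>interval (flats M2) {} K2. moebius (flats M2) {} H)"
        unfolding K sum_interval_direct_sum vim sum_product ..
      also have "\<dots> = (if {} = K1 then 1 else 0) * (if {} = K2 then 1 else 0)"
        using K' M1.empty_flat M2.empty_flat M1.finite_flat M2.finite_flat by (simp add: sum_moebius)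
      also have "\<dots> = (if {} = K then 1 else 0)" using K Plus_eq_iff[of "{}" "{}" K1 K2] by auto
      finally show ?thesis .
    qed
  qed (use M.empty_flat in auto)
  then show ?thesis by (simp add: vim)
qed

lemma char_poly_direct_sum: "char_poly M = char_poly M1 * char_poly M2"
  unfolding char_poly_def sum_flats_direct_sum sum_product
proof (intro sum.cong refl)
  fix F1 F2 assume F: "F1 \<in> flats M1" "F2 \<in> flats M2"
  have "rank_of M1 F1 \<le> rk M1" "rank_of M2 F2 \<le> rk M2"
    unfolding rk_def using F by (auto intro!: M1.rank_mono M2.rank_mono M1.flat_subset M2.flat_subset)
  then show "monom (moebius (flats M) {} (F1 <+> F2)) (rk M - rank_of M (F1 <+> F2)) =
      monom (moebius (flats M1) {} F1) (rk M1 - rank_of M1 F1) *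
      monom (moebius (flats M2) {} F2) (rk M2 - rank_of M2 F2)"
    using F by (simp add: moebius_direct_sum rk_direct_sum rank_direct_sum mult_monom)
qed

lemma localization_direct_sum:
  "localization M (F1 <+> F2) = direct_sum (localization M1 F1) (localization M2 F2)"
proof -
  have "{I \<in> indeps M. I \<subseteq> F1 <+> F2} =
      {I <+> J | I J. I \<in> {I \<in> indeps M1. I \<subseteq> F1} \<and> J \<in> {J \<in> indeps M2. J \<subseteq> F2}}"
    unfolding direct_sum_def by (auto simp: Plus_subset_iff)
  then show ?thesis by (simp add: localization_def direct_sum_def)
qed

lemma char_poly_localization_direct_sum:
  assumes "F1 \<in> flats M1" "F2 \<in> flats M2"
  shows "char_poly (localization M (F1 <+> F2)) =
    char_poly (localization M1 F1) * char_poly (localization M2 F2)"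
proof -
  interpret L: two_matroids "localization M1 F1" "localization M2 F2"
    using assms M1.flat_subset M2.flat_subset
    by (intro two_matroids.intro M1.localization_loopless M2.localization_loopless)
  show ?thesis unfolding localization_direct_sum by (rule L.char_poly_direct_sum)
qed

lemma contraction_direct_sum:
  assumes "F1 \<in> flats M1" "F2 \<in> flats M2"
  shows "contraction M (F1 <+> F2) = direct_sum (contraction M1 F1) (contraction M2 F2)"
proof -
  interpret C: two_matroids "contraction M1 F1" "contraction M2 F2"
    using assms by (intro two_matroids.intro M1.contraction_loopless M2.contraction_loopless)
  have sub: "F1 <+> F2 \<subseteq> ground M"
    using assms M.flat_subset flat_direct_sum by blast
  show ?thesis
  proof (rule loopless_matroid.matroid_eqI[OF M.contraction_loopless C.direct_sum_loopless])
    show "F1 <+> F2 \<in> flats M" using assms flat_direct_sum by blast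
    show g: "ground (contraction M (F1 <+> F2)) = ground C.M"
      by (auto simp: ground_direct_sum C.ground_direct_sum)
    fix X assume X: "X \<subseteq> ground (contraction M (F1 <+> F2))"
    obtain X1 X2 where X12: "X = X1 <+> X2" by (rule Plus_cases)
    then have X1: "X1 \<subseteq> ground M1 - F1" and X2: "X2 \<subseteq> ground M2 - F2"
      using X g by (auto simp: C.ground_direct_sum)
    have "X \<union> (F1 <+> F2) = (X1 \<union> F1) <+> (X2 \<union> F2)" using X12 by auto
    then show "rank_of (contraction M (F1 <+> F2)) X = rank_of C.M X"
      using M.rank_contraction[of X "F1 <+> F2"] X X12 M1.rank_contraction[OF X1]
        M2.rank_contraction[OF X2] M1.rank_mono[of F1 "X1 \<union> F1"] M2.rank_mono[of F2 "X2 \<union> F2"]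
      by (simp add: rank_direct_sum C.rank_direct_sum)
  qed
qed

end

text \<open>
  The product on the right solves the functional equation of the direct sum: its reversal is the
  product of the two functional equations, and by induction the terms of nonempty flats in that
  product are those of the direct sum. The degree bounds add up, where a summand of rank zero
  contributes the constant \<open>1\<close>.
\<close>

lemma KL_poly_direct_sum:
  assumes "loopless_matroid M1" "loopless_matroid M2"
  shows "KL_poly (direct_sum M1 M2) = KL_poly M1 * KL_poly M2"
  using assms
proof (induction "card (ground (direct_sum M1 M2))" arbitrary: M1 M2 rule: less_induct)
  case less
  interpret two_matroids M1 M2 using less.prems by (rule two_matroids.intro)
  let ?q = "KL_poly M1 * KL_poly M2"
  let ?S = "\<lambda>f. \<Sum>F\<in>flats M - {{}}. char_poly (localization M F) * f F"
  let ?Q = "\<lambda>F. KL_poly (contraction M1 (Inl -` F)) * KL_poly (contraction M2 (Inr -` F))"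
  have vim: "Inl -` (A <+> B) = A" "Inr -` (A <+> B) = B" for A :: "'a set" and B :: "'b set"
    by auto
  note KL = KL_at_KL_poly[OF M.loopless_matroid_axioms]
    KL_at_KL_poly[OF less.prems(1)] KL_at_KL_poly[OF less.prems(2)]
  have deg: "degree ?q \<le> degree (KL_poly M1) + degree (KL_poly M2)" by (rule degree_mult_le)
  have IH: "KL_poly (contraction M F) = ?Q F" if F: "F \<in> flats M - {{}}" for F
  proof -
    obtain F1 F2 where F12: "F = F1 <+> F2" by (rule Plus_cases)
    then have fl: "F1 \<in> flats M1" "F2 \<in> flats M2" using F flat_direct_sum by auto
    show ?thesis
      using less.hyps[of "contraction M1 F1" "contraction M2 F2"] M.card_ground_contraction[of F] F
      by (simp add: F12 contraction_direct_sum[OF fl] vim M1.contraction_loopless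
          M2.contraction_loopless fl)
  qed
  have "?S (\<lambda>F. KL_poly (contraction M F)) = ?S ?Q"
    using IH by (intro sum.cong refl) simp
  then have P: "flip_poly (rk M) (KL_poly M) = KL_poly M + ?S ?Q"
    using KL(1) by (simp add: KL_at_def M.KL_sum_split)
  have "flip_poly (rk M) ?q = (\<Sum>F\<in>flats M. char_poly (localization M F) * ?Q F)"
  proof -
    have "flip_poly (rk M) ?q =
        flip_poly (rk M1) (KL_poly M1) * flip_poly (rk M2) (KL_poly M2)"
      using KL unfolding rk_direct_sum by (intro flip_poly_mult KL_at_degree)
    also have "\<dots> = (\<Sum>F1\<in>flats M1. \<Sum>F2\<in>flats M2.
        char_poly (localization M (F1 <+> F2)) * ?Q (F1 <+> F2))"
      using KL unfolding KL_at_def vim sum_product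
      by (simp add: sum_product char_poly_localization_direct_sum mult_ac)
    finally show ?thesis by (simp only: sum_flats_direct_sum)
  qed
  also have "\<dots> = ?q + ?S ?Q"
    by (subst sum.remove[OF M.finite_flats M.empty_flat]) simp
  finally have Q: "flip_poly (rk M) ?q = ?q + ?S ?Q" .
  show ?case
  proof (rule KL_step_unique[OF _ _ _ P Q])
    show "2 * degree ?q < rk M" if "rk M > 0"
      using that deg KL(2,3) unfolding KL_at_def rk_direct_sum
      by (cases "rk M1 = 0"; cases "rk M2 = 0") auto
  qed (use KL in \<open>auto simp: KL_at_def rk_direct_sum\<close>)
qed

theorem corollary5p2:
  fixes M1 :: "'a matroid" and M2 :: "'b matroid"
  assumes "loopless_matroid M1" and "loopless_matroid M2"
  shows "microlocal_mult (direct_sum M1 M2) = microlocal_mult M1 * microlocal_mult M2"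
proof -
  interpret two_matroids M1 M2 using assms by (rule two_matroids.intro)
  have "2 ^ rank_of M (F1 <+> F2) *
       poly (rat_poly (char_poly (localization M (F1 <+> F2)))) (1 / 2) *
       of_int (poly (KL_poly (contraction M (F1 <+> F2))) 1) =
      (2 ^ rank_of M1 F1 * poly (rat_poly (char_poly (localization M1 F1))) (1 / 2) *
       of_int (poly (KL_poly (contraction M1 F1)) 1)) *
      (2 ^ rank_of M2 F2 * poly (rat_poly (char_poly (localization M2 F2))) (1 / 2) *
       of_int (poly (KL_poly (contraction M2 F2)) 1))"
    if F: "F1 \<in> flats M1" "F2 \<in> flats M2" for F1 F2
    using F by (simp add: rank_direct_sum char_poly_localization_direct_sum contraction_direct_sum
        KL_poly_direct_sum M1.contraction_loopless M2.contraction_loopless power_add rat_poly_mult)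
  then show ?thesis
    unfolding microlocal_mult_def sum_flats_direct_sum rk_direct_sum
    by (simp add: power_add sum_product mult_ac)
qed

end
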